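(* Let $(H_i)_{i\ge1},(U_i)_{i\ge1},(V_i)_{i\ge1}$ be sequences of stable scalar systems for which there are constants $\gamma_h,\gamma_u,\gamma_v<\infty$ with $\|H_i\|\le\gamma_h$, $\|U_i\|\le\gamma_u$, $\|V_i\|\le\gamma_v$ for all $i$. Let $(\gamma_i)_{i\ge1}$ be constants with $0<\gamma_i<\infty$ and $\sup_i\gamma_i<\infty$, and let $\alpha=\alpha(n)>0$ satisfy $\alpha(n)=o(\sqrt n)$ as $n\to\infty$. For each $n$ put $$\psi^o_{2,n}:=\inf_{Q\in\mathcal Q^{\alpha}_n}\frac1{\sqrt n}\big\|\mathbf T_n\,(H^{(n)}-U^{(n)}QV^{(n)})\big\|_2,\qquad \mu^o_{2,n}:=\inf_{Q\in\mathcal Q^{\alpha}_n}\frac1{\sqrt n}\big\|H^{(n)}-U^{(n)}QV^{(n)}\big\|_2 .$$ Then $$\lim_{n\to\infty}\big(\psi^o_{2,n}-\mu^o_{2,n}\big)=0 .$$ Moreover, the solution $Q$ of the minimization problem defining $\mu^o_{2,n}$ is decentralized (diagonal), and it also minimizes the problem defining $\psi^o_{2,n}$ for large enough $n$.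
   Context: A stable scalar system is a causal discrete-time LTI SISO system with real impulse response $(M_k)_{k\ge0}$, identified with its transfer function $M(\lambda)=\sum_{k\ge0}M_k\lambda^k$, having finite $\mathcal H_\infty$ norm. For a (matrix-valued) stable transfer function, $\|M\|:=\sup_\omega\sigma_{\max}[M(e^{\jmath\omega})]$ (no subscript) denotes the $\mathcal H_\infty$ norm, with $\sigma_{\max}$ the largest singular value. The $\mathcal H_2$ norm is $\|M\|_2:=(\sum_k M_k^2)^{1/2}$ for scalar $M$ and $\|M\|_2:=(\sum_{i,j}\|M_{ij}\|_2^2)^{1/2}$ for $M=[M_{ij}]$. $H^{(n)}=\mathrm{diag}(H_1,\dots,H_n)$, $U^{(n)}=\mathrm{diag}(U_1,\dots,U_n)$, $V^{(n)}=\mathrm{diag}(V_1,\dots,V_n)$. $\mathbf T_n:=I_n-\frac1n\mathbf 1\mathbf 1^\top$, where $\mathbf 1$ is the all-ones vector of length $n$. For $\alpha>0$, an $n\times n$ matrix $Q=[Q_{ij}]$ of stable scalar systems is $\alpha$-column diagonal dominant if $\alpha\|Q_{jj}\|\ge\sum_{i\ne j}\|Q_{ij}\|$ for all $j=1,\dots,n$. $\mathcal Q^\alpha_n$ is the set of all $n\times n$ matrices $Q$ of stable scalar systems which are $\alpha(n)$-column diagonal dominant and satisfy $\|Q_{ii}\|\le\gamma_i$ for $1\le i\le n$. Interpretation: $\Phi=H-UQV$ is the closed-loop map from disturbances $w$ to regulated signals $z$ of $n$ decoupled agents in Youla parametrization, and $\Psi=\mathbf T_n\Phi$ is the map from $w$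 to the deviations $z_i-\frac1n\sum_j z_j$. A diagonal $Q$ corresponds to a decentralized controller. Convention: existence of optimal solutions is assumed; where existence is not guaranteed, "optimal" is replaced by "arbitrarily close to optimal".
   Formalization: The exact claims fail in general; proved instead: for any ε>0 and all large n, every μ-solution is within ε of optimal for the ψ-problem, and a μ-solution has Q_ij=0 (i≠j) when U_i and V_j are nonzero, its diagonal part always being a μ-solution. *)

theory Defs
  imports
    "HOL-Complex_Analysis.Complex_Analysis"
    "HOL-Library.Landau_Symbols"
    "Jordan_Normal_Form.Matrix"
begin

text \<open>
  A causal LTI SISO system is given by its real impulse response, packaged as the formal power
  series \<open>M = (\<Sum>k. M\<^sub>k \<lambda>\<^sup>k)\<close>. Series connection, i.e. convolution of impulse responses, is then
  multiplication of power series.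
\<close>

type_synonym system = "real fps"

definition transfer_fps :: "system \<Rightarrow> complex fps" where
  "transfer_fps M = Abs_fps (\<lambda>k. complex_of_real (fps_nth M k))"

definition transfer :: "system \<Rightarrow> complex \<Rightarrow> complex" where
  "transfer M z = eval_fps (transfer_fps M) z"

text \<open>
  The variable \<open>\<lambda>\<close> is the unit delay, so stability means that the transfer function is analytic
  and bounded in the open unit disc. A general such function has boundary values only almost
  everywhere on the unit circle; the supremum over the circle is therefore taken as the
  Hardy space norm, the supremum of the modulus over the open disc. Lemma
  \<open>hinf_norm_eq_circle\<close> below shows that this is the supremum over all frequencies of the
  modulus of the frequency response whenever the impulse response is absolutely summable.
\<close>

definition stable_system :: "system \<Rightarrow> bool" where
  "stable_system M \<longleftrightarrow>
     1 \<le> fps_conv_radius (transfer_fps M) \<and> bounded (transfer M ` ball 0 1)"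

definition hinf_norm :: "system \<Rightarrow> real" where
  "hinf_norm M = (SUP z\<in>ball 0 1. cmod (transfer M z))"

definition h2_norm :: "system \<Rightarrow> real" where
  "h2_norm M = sqrt (\<Sum>k. (fps_nth M k)\<^sup>2)"

definition h2_norm_mat :: "system mat \<Rightarrow> real" where
  "h2_norm_mat M = sqrt (\<Sum>i<dim_row M. \<Sum>j<dim_col M. (h2_norm (M $$ (i, j)))\<^sup>2)"

text \<open>Rows, columns and agents are numbered from \<open>0\<close>.\<close>

definition col_diag_dominant :: "real \<Rightarrow> nat \<Rightarrow> system mat \<Rightarrow> bool" where
  "col_diag_dominant a n Q \<longleftrightarrow>
     (\<forall>j<n. a * hinf_norm (Q $$ (j, j)) \<ge> (\<Sum>i\<in>{..<n} - {j}. hinf_norm (Q $$ (i, j))))"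

definition feasible :: "(nat \<Rightarrow> real) \<Rightarrow> (nat \<Rightarrow> real) \<Rightarrow> nat \<Rightarrow> system mat set" where
  "feasible \<alpha> \<gamma> n =
     {Q \<in> carrier_mat n n.
        (\<forall>i<n. \<forall>j<n. stable_system (Q $$ (i, j))) \<and>
        col_diag_dominant (\<alpha> n) n Q \<and>
        (\<forall>i<n. hinf_norm (Q $$ (i, i)) \<le> \<gamma> i)}"

definition deviation_mat :: "nat \<Rightarrow> system mat" where
  "deviation_mat n = 1\<^sub>m n - fps_const (1 / real n) \<cdot>\<^sub>m Matrix.mat n n (\<lambda>_. 1)"

definition closed_loop ::
    "(nat \<Rightarrow> system) \<Rightarrow> (nat \<Rightarrow> system) \<Rightarrow> (nat \<Rightarrow> system) \<Rightarrow> nat \<Rightarrow> system mat \<Rightarrow> system mat" where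
  "closed_loop H U V n Q = mat_diag n H - mat_diag n U * Q * mat_diag n V"

definition mu_cost ::
    "(nat \<Rightarrow> system) \<Rightarrow> (nat \<Rightarrow> system) \<Rightarrow> (nat \<Rightarrow> system) \<Rightarrow> nat \<Rightarrow> system mat \<Rightarrow> real" where
  "mu_cost H U V n Q = 1 / sqrt (real n) * h2_norm_mat (closed_loop H U V n Q)"

definition psi_cost ::
    "(nat \<Rightarrow> system) \<Rightarrow> (nat \<Rightarrow> system) \<Rightarrow> (nat \<Rightarrow> system) \<Rightarrow> nat \<Rightarrow> system mat \<Rightarrow> real" where
  "psi_cost H U V n Q =
     1 / sqrt (real n) * h2_norm_mat (deviation_mat n * closed_loop H U V n Q)"

definition minimal_value :: "('a \<Rightarrow> real) \<Rightarrow> 'a set \<Rightarrow> real" where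
  "minimal_value f S = (INF x\<in>S. f x)"

definition near_minimizer :: "('a \<Rightarrow> real) \<Rightarrow> 'a set \<Rightarrow> real \<Rightarrow> 'a \<Rightarrow> bool" where
  "near_minimizer f S \<epsilon> x \<longleftrightarrow> x \<in> S \<and> f x \<le> minimal_value f S + \<epsilon>"

lemma is_arg_min_iff_near_minimizer:
  assumes "\<And>x. x \<in> S \<Longrightarrow> 0 \<le> f x"
  shows "is_arg_min f (\<lambda>x. x \<in> S) x \<longleftrightarrow> near_minimizer f S 0 x"
proof -
  have "bdd_below (f ` S)"
    using assms by (intro bdd_belowI[of _ 0]) auto
  then show ?thesis
    unfolding is_arg_min_linorder near_minimizer_def minimal_value_def
    by (auto intro: cINF_greatest dest: cINF_lower order_trans)
qed

lemma hinf_norm_eq_circle: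
  assumes sm: "summable (\<lambda>k. \<bar>fps_nth M k\<bar>)"
  shows "stable_system M"
    and "hinf_norm M = (SUP \<omega>. cmod (\<Sum>k. of_real (fps_nth M k) * exp (\<i> * of_real \<omega>) ^ k))"
proof -
  let ?f = "transfer M"
  have f_eq: "?f z = (\<Sum>k. of_real (fps_nth M k) * z ^ k)" for z
    by (simp add: transfer_def transfer_fps_def eval_fps_def)
  have term_le: "norm (complex_of_real (fps_nth M k) * z ^ k) \<le> \<bar>fps_nth M k\<bar>"
    if "z \<in> cball 0 1" for z k
    using that by (simp add: norm_mult norm_power mult_left_le power_le_one)
  have "summable (\<lambda>k. fps_nth (transfer_fps M) k * 1 ^ k)"
    using sm by (simp add: transfer_fps_def summable_of_real_iff summable_rabs_cancel
        flip: of_real_sum)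
  from conv_radius_geI[OF this] have rad: "1 \<le> fps_conv_radius (transfer_fps M)"
    by (simp add: fps_conv_radius_def one_ereal_def)
  have cont: "continuous_on (cball 0 1) ?f"
  proof -
    have "uniform_limit (cball 0 1) (\<lambda>n z. \<Sum>k<n. complex_of_real (fps_nth M k) * z ^ k)
            (\<lambda>z. \<Sum>k. of_real (fps_nth M k) * z ^ k) sequentially"
      using term_le sm by (intro Weierstrass_m_test) auto
    then have "continuous_on (cball 0 1) (\<lambda>z. \<Sum>k. complex_of_real (fps_nth M k) * z ^ k)"
      by (rule uniform_limit_theorem[rotated]) (auto intro!: always_eventually continuous_intros)
    then show ?thesis by (simp add: f_eq)
  qed
  have hol: "?f holomorphic_on ball 0 1"
  proof -
    have "eval_fps (transfer_fps M) holomorphic_on eball 0 1"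
      using rad by (intro holomorphic_on_eval_fps eball_mono)
    moreover have "ball (0::complex) 1 \<subseteq> eball 0 1"
      by (auto simp: eball_def one_ereal_def)
    ultimately show ?thesis
      unfolding transfer_def [abs_def] by (rule holomorphic_on_subset)
  qed
  have bdd_img: "bounded (?f ` cball 0 1)"
    using cont by (intro compact_imp_bounded compact_continuous_image) auto
  then have bdd_ball: "bounded (?f ` ball 0 1)"
    by (rule bounded_subset) auto
  from rad bdd_ball show "stable_system M"
    by (simp add: stable_system_def)
  obtain B where B: "\<And>z. z \<in> cball 0 1 \<Longrightarrow> cmod (?f z) \<le> B"
    using bdd_img unfolding bounded_iff by blast
  let ?e = "\<lambda>\<omega>::real. exp (\<i> * of_real \<omega>)"
  have bdd1: "bdd_above ((\<lambda>z. cmod (?f z)) ` ball 0 1)"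
    using B by (intro bdd_aboveI[of _ B]) auto
  have bdd2: "bdd_above (range (\<lambda>\<omega>. cmod (?f (?e \<omega>))))"
    using B by (intro bdd_aboveI[of _ B]) auto
  have "hinf_norm M = (SUP \<omega>. cmod (?f (?e \<omega>)))"
    unfolding hinf_norm_def
  proof (rule antisym)
    show "(SUP z\<in>ball 0 1. cmod (?f z)) \<le> (SUP \<omega>. cmod (?f (?e \<omega>)))"
    proof (rule cSUP_least)
      fix z :: complex assume z: "z \<in> ball 0 1"
      show "cmod (?f z) \<le> (SUP \<omega>. cmod (?f (?e \<omega>)))"
      proof (rule maximum_modulus_frontier[of ?f "ball 0 1"])
        fix w :: complex assume "w \<in> frontier (ball 0 1)"
        then have "norm w = 1" by simp
        then obtain t where "w = ?e t"
          using complex_norm_eq_1_exp by (metis)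
        then show "cmod (?f w) \<le> (SUP \<omega>. cmod (?f (?e \<omega>)))"
          using cSUP_upper[OF UNIV_I bdd2] by simp
      qed (use hol cont z in auto)
    qed auto
    show "(SUP \<omega>. cmod (?f (?e \<omega>))) \<le> (SUP z\<in>ball 0 1. cmod (?f z))"
    proof (rule cSUP_least)
      fix \<omega> :: real
      have "cmod (?f (?e \<omega>)) \<le> (SUP z\<in>ball 0 1. cmod (?f z))"
      proof (rule continuous_on_closure_norm_le[of "ball 0 1" ?f])
        show "continuous_on (closure (ball 0 1)) ?f" using cont by simp
        show "\<forall>y\<in>ball 0 1. cmod (?f y) \<le> (SUP z\<in>ball 0 1. cmod (?f z))"
          using cSUP_upper[OF _ bdd1] by blast
        show "?e \<omega> \<in> closure (ball 0 1)" by simp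
      qed
      then show "cmod (?f (?e \<omega>)) \<le> (SUP z\<in>ball 0 1. cmod (?f z))" .
    qed auto
  qed
  then show "hinf_norm M = (SUP \<omega>. cmod (\<Sum>k. of_real (fps_nth M k) * exp (\<i> * of_real \<omega>) ^ k))"
    by (simp only: f_eq)
qed

end

theory Submission
  imports Defs "HOL-Real_Asymp.Real_Asymp"
begin

text \<open>
  By Pythagoras for the deviation from the mean, applied column by column, \<open>\<mu>(Q)\<^sup>2\<close> exceeds
  \<open>\<psi>(Q)\<^sup>2\<close> by \<open>(\<Sum>j. \<parallel>s\<^sub>j\<parallel>\<^sub>2\<^sup>2) / n\<^sup>2\<close>, where \<open>s\<^sub>j\<close> is the sum of column \<open>j\<close> of the
  closed loop. Since the H2 norm is at most the H-infinity norm, diagonal dominance bounds \<open>\<parallel>s\<^sub>j\<parallel>\<^sub>2\<close>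
  by a constant times \<open>1 + \<alpha>(n)\<close>, so the two costs differ by \<open>O((1 + \<alpha>(n)) / sqrt n)\<close>, uniformly
  over the feasible set. Discarding the off-diagonal part of \<open>Q\<close> preserves feasibility and removes
  the terms \<open>\<parallel>U\<^sub>i Q\<^sub>i\<^sub>j V\<^sub>j\<parallel>\<^sub>2\<^sup>2\<close> with \<open>i \<noteq> j\<close> from \<open>n \<mu>(Q)\<^sup>2\<close>.
\<close>

section \<open>The algebra of stable systems\<close>

lemma transfer_fps_nth [simp]: "fps_nth (transfer_fps M) k = of_real (fps_nth M k)"
  by (simp add: transfer_fps_def)

lemma transfer_fps_add: "transfer_fps (M + N) = transfer_fps M + transfer_fps N"
  by (simp add: fps_eq_iff)

lemma transfer_fps_diff: "transfer_fps (M - N) = transfer_fps M - transfer_fps N"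
  by (simp add: fps_eq_iff)

lemma transfer_fps_mult: "transfer_fps (M * N) = transfer_fps M * transfer_fps N"
  by (simp add: fps_eq_iff fps_mult_nth)

lemma transfer_fps_const: "transfer_fps (fps_const c) = fps_const (of_real c)"
  by (simp add: fps_eq_iff)

lemma stable_system_conv_radius: "stable_system M \<Longrightarrow> 1 \<le> fps_conv_radius (transfer_fps M)"
  by (simp add: stable_system_def)

text \<open>The radius of convergence may be exactly 1. Strictness comes from \<open>z\<close> lying
  in the open disc, and the evaluation rules for sums and products of power series require
  it.\<close>

lemma stable_system_less_conv_radius:
  assumes "stable_system M" "z \<in> ball 0 1"
  shows "ereal (norm z) < fps_conv_radius (transfer_fps M)"
proof -
  have "ereal (norm z) < 1"
    using assms(2) by (simp add: one_ereal_def)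
  then show ?thesis
    using stable_system_conv_radius[OF assms(1)] by (rule less_le_trans)
qed

lemma stable_systemI:
  assumes "1 \<le> fps_conv_radius (transfer_fps M)"
    and "\<And>z. z \<in> ball 0 1 \<Longrightarrow> cmod (transfer M z) \<le> B"
  shows "stable_system M"
  using assms unfolding stable_system_def bounded_iff by blast

lemma norm_transfer_le_hinf_norm:
  assumes "stable_system M" "z \<in> ball 0 1"
  shows "cmod (transfer M z) \<le> hinf_norm M"
proof -
  obtain B where "\<forall>z\<in>ball 0 1. cmod (transfer M z) \<le> B"
    using assms(1) unfolding stable_system_def bounded_iff by auto
  then have "bdd_above ((\<lambda>z. cmod (transfer M z)) ` ball 0 1)"
    by (intro bdd_aboveI[of _ B]) auto
  then show ?thesis
    unfolding hinf_norm_def using assms(2) by (intro cSUP_upper)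
qed

lemma hinf_norm_leI:
  assumes "\<And>z. z \<in> ball 0 1 \<Longrightarrow> cmod (transfer M z) \<le> B"
  shows "hinf_norm M \<le> B"
  unfolding hinf_norm_def using assms by (intro cSUP_least) auto

text \<open>Stability enters because the supremum of an unbounded set of reals is an unspecified
  value.\<close>

lemma hinf_norm_nonneg: "stable_system M \<Longrightarrow> 0 \<le> hinf_norm M"
  using norm_transfer_le_hinf_norm[of M 0] norm_ge_zero[of "transfer M 0"]
  by (simp del: norm_ge_zero)

lemma transfer_add:
  assumes "stable_system M" "stable_system N" "z \<in> ball 0 1"
  shows "transfer (M + N) z = transfer M z + transfer N z"
  using assms unfolding transfer_def transfer_fps_add
  by (intro eval_fps_add stable_system_less_conv_radius)

lemma transfer_diff:
  assumes "stable_system M" "stable_system N" "z \<in> ball 0 1"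
  shows "transfer (M - N) z = transfer M z - transfer N z"
  using assms unfolding transfer_def transfer_fps_diff
  by (intro eval_fps_diff stable_system_less_conv_radius)

lemma transfer_mult:
  assumes "stable_system M" "stable_system N" "z \<in> ball 0 1"
  shows "transfer (M * N) z = transfer M z * transfer N z"
  using assms unfolding transfer_def transfer_fps_mult
  by (intro eval_fps_mult stable_system_less_conv_radius)

section \<open>Closure of the stable systems under ring operations, with norm bounds\<close>

text \<open>A single pointwise estimate on the disc yields both claims: it gives boundedness, hence
  stability, and it bounds the supremum. The same scheme serves differences and products.\<close>

lemma
  assumes "stable_system M" "stable_system N"
  shows stable_system_add: "stable_system (M + N)"
    and hinf_norm_add_le: "hinf_norm (M + N) \<le> hinf_norm M + hinf_norm N"
proof -
  have le: "cmod (transfer (M + N) z) \<le> hinf_norm M + hinf_norm N" if "z \<in> ball 0 1" for z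
    unfolding transfer_add[OF assms that]
    using assms that by (intro norm_triangle_mono norm_transfer_le_hinf_norm)
  have "1 \<le> fps_conv_radius (transfer_fps (M + N))"
    using fps_conv_radius_add[of "transfer_fps M" "transfer_fps N"]
      assms[THEN stable_system_conv_radius]
    unfolding transfer_fps_add by (auto simp: min_def intro: order_trans split: if_splits)
  then show "stable_system (M + N)"
    using le by (rule stable_systemI)
  show "hinf_norm (M + N) \<le> hinf_norm M + hinf_norm N"
    using le by (rule hinf_norm_leI)
qed

lemma
  assumes "stable_system M" "stable_system N"
  shows stable_system_diff: "stable_system (M - N)"
    and hinf_norm_diff_le: "hinf_norm (M - N) \<le> hinf_norm M + hinf_norm N"
proof -
  have le: "cmod (transfer (M - N) z) \<le> hinf_norm M + hinf_norm N" if "z \<in> ball 0 1" for z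
    unfolding transfer_diff[OF assms that]
    using assms that
    by (intro order_trans[OF norm_triangle_ineq4] add_mono norm_transfer_le_hinf_norm)
  have "1 \<le> fps_conv_radius (transfer_fps (M - N))"
    using fps_conv_radius_diff[of "transfer_fps M" "transfer_fps N"]
      assms[THEN stable_system_conv_radius]
    unfolding transfer_fps_diff by (auto simp: min_def intro: order_trans split: if_splits)
  then show "stable_system (M - N)"
    using le by (rule stable_systemI)
  show "hinf_norm (M - N) \<le> hinf_norm M + hinf_norm N"
    using le by (rule hinf_norm_leI)
qed

lemma
  assumes "stable_system M" "stable_system N"
  shows stable_system_mult: "stable_system (M * N)"
    and hinf_norm_mult_le: "hinf_norm (M * N) \<le> hinf_norm M * hinf_norm N"
proof -
  have le: "cmod (transfer (M * N) z) \<le> hinf_norm M * hinf_norm N" if "z \<in> ball 0 1" for z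
    unfolding transfer_mult[OF assms that] norm_mult
    using assms that by (intro mult_mono norm_transfer_le_hinf_norm hinf_norm_nonneg norm_ge_zero)
  have "1 \<le> fps_conv_radius (transfer_fps (M * N))"
    using fps_conv_radius_mult[of "transfer_fps M" "transfer_fps N"]
      assms[THEN stable_system_conv_radius]
    unfolding transfer_fps_mult by (auto simp: min_def intro: order_trans split: if_splits)
  then show "stable_system (M * N)"
    using le by (rule stable_systemI)
  show "hinf_norm (M * N) \<le> hinf_norm M * hinf_norm N"
    using le by (rule hinf_norm_leI)
qed

lemma transfer_const: "transfer (fps_const c) z = of_real c"
  by (simp add: transfer_def transfer_fps_const)

lemma stable_system_const: "stable_system (fps_const c)"
  by (rule stable_systemI[of _ "\<bar>c\<bar>"]) (simp_all add: transfer_const transfer_fps_const)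

lemma stable_system_0: "stable_system 0"
  using stable_system_const[of 0] by simp

lemma hinf_norm_0 [simp]: "hinf_norm 0 = 0"
  using transfer_const[of 0] by (simp add: hinf_norm_def)

lemma stable_system_sum:
  assumes "\<And>i. i \<in> A \<Longrightarrow> stable_system (f i)"
  shows "stable_system (sum f A)"
  using assms
  by (induction A rule: infinite_finite_induct) (auto simp: stable_system_0 stable_system_add)

lemma hinf_norm_sum_le:
  assumes "\<And>i. i \<in> A \<Longrightarrow> stable_system (f i)"
  shows "hinf_norm (sum f A) \<le> (\<Sum>i\<in>A. hinf_norm (f i))"
  using assms
proof (induction A rule: infinite_finite_induct)
  case (insert x F)
  have "hinf_norm (f x + sum f F) \<le> hinf_norm (f x) + hinf_norm (sum f F)"
    using insert.prems by (intro hinf_norm_add_le stable_system_sum) auto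
  then show ?case
    using insert by fastforce
qed auto

section \<open>Comparison of the two norms\<close>

text \<open>
  Averaging over roots of unity instead of integrating over a circle keeps Parseval's identity for
  polynomials a finite computation; the coefficient bound below passes to the limit in the number
  of roots for a radius \<open>r < 1\<close>, and only then lets \<open>r\<close> tend to \<open>1\<close>.
\<close>

lemma sum_roots_of_unity_powers:
  fixes k l N :: nat
  assumes "k < N" "l < N"
  defines "\<omega> \<equiv> \<lambda>m::nat. cis (2 * pi * real m / real N)"
  shows "(\<Sum>m<N. \<omega> m ^ k * cnj (\<omega> m) ^ l) = (if k = l then of_nat N else 0)"
proof -
  have N: "N > 0" using assms by simp
  \<comment> \<open>Exchanging the roles of exponent and index turns the sum over \<open>m\<close>
    into a geometric sum with ratio \<open>\<omega> k * cnj (\<omega> l)\<close>.\<close>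
  have pow: "\<omega> m ^ k * cnj (\<omega> m) ^ l = (\<omega> k * cnj (\<omega> l)) ^ m" for m
    by (simp add: \<omega>_def cis_cnj Complex.DeMoivre cis_mult algebra_simps)
  show ?thesis
  proof (cases "k = l")
    case True
    then show ?thesis
      unfolding pow by (simp add: \<omega>_def cis_cnj cis_mult)
  next
    case False
    let ?z = "\<omega> k * cnj (\<omega> l)"
    have root: "\<omega> j ^ N = 1" for j
      using N cis_multiple_2pi[of "real j"] by (simp add: \<omega>_def Complex.DeMoivre)
    \<comment> \<open>Here \<open>k < N\<close> and \<open>l < N\<close> matter: distinct residues
      give distinct roots, so the ratio is an \<open>N\<close>-th root of unity other than 1 and the
      geometric sum vanishes.\<close>
    have "inj_on \<omega> {..<N}"
      using Complex.bij_betw_roots_unity[OF N] unfolding \<omega>_def bij_betw_def by blast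
    then have "\<omega> k \<noteq> \<omega> l"
      using False assms(1,2) by (auto dest: inj_onD)
    moreover have "\<omega> l * cnj (\<omega> l) = 1"
      by (simp add: \<omega>_def cis_cnj cis_mult)
    ultimately have "?z \<noteq> 1"
      by (metis mult.commute mult.right_neutral mult_cancel_right zero_neq_one mult_zero_right)
    moreover have "?z ^ N = 1"
      using root by (simp add: power_mult_distrib flip: complex_cnj_power)
    ultimately show ?thesis
      unfolding pow using False by (simp add: geometric_sum)
  qed
qed

text \<open>Expanding the squared modulus and summing over the roots first leaves only the terms
  \<open>k = l\<close>. The degree stays below the number \<open>N\<close> of roots, so no two
  powers coincide on them.\<close>

lemma discrete_Parseval:
  fixes b :: "nat \<Rightarrow> real" and N :: nat
  defines "\<omega> \<equiv> \<lambda>m::nat. cis (2 * pi * real m / real N)"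
  shows "(\<Sum>m<N. (cmod (\<Sum>k<N. of_real (b k) * \<omega> m ^ k))\<^sup>2) = real N * (\<Sum>k<N. (b k)\<^sup>2)"
proof -
  \<comment> \<open>The computation is done in the complex numbers, where a squared modulus factors
    as \<open>z * cnj z\<close>; injectivity of the embedding brings it back to the reals.\<close>
  have "complex_of_real (\<Sum>m<N. (cmod (\<Sum>k<N. of_real (b k) * \<omega> m ^ k))\<^sup>2)
      = (\<Sum>m<N. \<Sum>k<N. \<Sum>l<N. of_real (b k) * of_real (b l) * (\<omega> m ^ k * cnj (\<omega> m) ^ l))"
    by (simp add: complex_norm_square sum_product mult_ac del: of_real_power
        flip: of_real_power)
  also have "\<dots> = (\<Sum>k<N. \<Sum>l<N. \<Sum>m<N.
      of_real (b k) * of_real (b l) * (\<omega> m ^ k * cnj (\<omega> m) ^ l))"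
    by (rule trans[OF sum.swap], rule sum.cong[OF refl], rule sum.swap)
  also have "\<dots> = (\<Sum>k<N. \<Sum>l<N. of_real (b k) * of_real (b l) * (if k = l then of_nat N else 0))"
    unfolding sum_distrib_left[symmetric] \<omega>_def
    by (intro sum.cong refl arg_cong2[of _ _ _ _ "(*)"] sum_roots_of_unity_powers) auto
  also have "\<dots> = (\<Sum>k<N. of_nat N * of_real ((b k)\<^sup>2))"
    by (intro sum.cong refl) (simp add: if_distrib sum.delta power2_eq_square mult_ac cong: if_cong)
  also have "\<dots> = complex_of_real (real N * (\<Sum>k<N. (b k)\<^sup>2))"
    by (simp add: sum_distrib_left)
  finally show ?thesis
    by (simp only: of_real_eq_iff)
qed

text \<open>The scaled coefficients describe the transfer function on the circle of radius
  \<open>r\<close>, where its modulus is at most \<open>hinf_norm M\<close>. Truncation after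
  \<open>N\<close> terms costs at most a tail that tends to 0, and Parseval with \<open>N\<close>
  roots handles the truncated polynomial.\<close>

lemma sum_scaled_coeff_squares_le:
  assumes M: "stable_system M" and r: "0 < r" "r < 1"
  shows "(\<Sum>k<K. (fps_nth M k * r ^ k)\<^sup>2) \<le> (hinf_norm M)\<^sup>2"
proof -
  let ?F = "transfer_fps M"
  let ?b = "\<lambda>k. fps_nth M k * r ^ k"
  have abs_sum: "summable (\<lambda>k. \<bar>?b k\<bar>)"
  proof -
    have "ereal (norm (complex_of_real r)) < fps_conv_radius ?F"
      using r by (intro stable_system_less_conv_radius[OF M]) simp
    then have "summable (\<lambda>k. norm (fps_nth ?F k * of_real r ^ k))"
      unfolding fps_conv_radius_def by (rule abs_summable_in_conv_radius)
    then show ?thesis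
      using r by (simp add: norm_mult norm_power abs_mult)
  qed
  \<comment> \<open>The tail of the absolutely convergent series bounds the truncation error
    uniformly on the circle.\<close>
  define T where "T = (\<lambda>N. \<Sum>k. \<bar>?b (k + N)\<bar>)"
  have T_lim: "T \<longlonglongrightarrow> 0"
    using suminf_exist_split2[OF abs_sum] by (simp add: T_def)
  have T_nonneg: "0 \<le> T N" for N
    unfolding T_def using abs_sum by (intro suminf_nonneg summable_ignore_initial_segment) auto
  have poly_le: "cmod (\<Sum>k<N. of_real (?b k) * w ^ k) \<le> hinf_norm M + T N"
    if w: "cmod w = 1" for w N
  proof -
    let ?g = "\<lambda>k. complex_of_real (?b k) * w ^ k"
    have norm_g: "norm (?g k) = \<bar>?b k\<bar>" for k
      using w by (simp add: norm_mult norm_power abs_mult power_abs)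
    have ng_sum: "summable (\<lambda>k. norm (?g k))"
      using abs_sum unfolding norm_g .
    then have g_sum: "summable ?g"
      by (rule summable_norm_cancel)
    have "transfer M (of_real r * w) = suminf ?g"
      by (simp add: transfer_def eval_fps_def power_mult_distrib mult_ac)
    also have "\<dots> = (\<Sum>k. ?g (k + N)) + (\<Sum>k<N. ?g k)"
      by (rule suminf_split_initial_segment[OF g_sum])
    finally have "(\<Sum>k<N. ?g k) = transfer M (of_real r * w) - (\<Sum>k. ?g (k + N))"
      by simp
    also have "cmod \<dots> \<le> cmod (transfer M (of_real r * w)) + cmod (\<Sum>k. ?g (k + N))"
      by (rule norm_triangle_ineq4)
    also have "cmod (transfer M (of_real r * w)) \<le> hinf_norm M"
      using r w by (intro norm_transfer_le_hinf_norm M) (simp add: norm_mult)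
    also have "cmod (\<Sum>k. ?g (k + N)) \<le> (\<Sum>k. norm (?g (k + N)))"
      using ng_sum by (intro summable_norm) (rule summable_ignore_initial_segment)
    also have "\<dots> = T N"
      unfolding T_def norm_g ..
    finally show ?thesis
      by simp
  qed
  \<comment> \<open>\<open>Suc K\<close> rather than \<open>K\<close> ensures \<open>N > 0\<close>,
    so that the factor \<open>real N\<close> of Parseval's identity can be cancelled.\<close>
  have le: "(\<Sum>k<K. (?b k)\<^sup>2) \<le> (hinf_norm M + T N)\<^sup>2" if N: "N \<ge> Suc K" for N
  proof -
    have "real N * (\<Sum>k<N. (?b k)\<^sup>2) \<le> (\<Sum>m<N. (hinf_norm M + T N)\<^sup>2)"
      unfolding discrete_Parseval[symmetric]
      by (intro sum_mono power_mono poly_le) auto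
    then have "(\<Sum>k<N. (?b k)\<^sup>2) \<le> (hinf_norm M + T N)\<^sup>2"
      using N by simp
    moreover have "(\<Sum>k<K. (?b k)\<^sup>2) \<le> (\<Sum>k<N. (?b k)\<^sup>2)"
      using N by (intro sum_mono2) auto
    ultimately show ?thesis
      by simp
  qed
  have "(\<lambda>N. (hinf_norm M + T N)\<^sup>2) \<longlonglongrightarrow> (hinf_norm M + 0)\<^sup>2"
    by (intro tendsto_intros T_lim)
  then show ?thesis
    using le by (intro LIMSEQ_le_const[of _ "(hinf_norm M)\<^sup>2"]) auto
qed

text \<open>With \<open>K\<close> fixed the scaled sum is a polynomial in \<open>r\<close>, so its
  bound survives the limit from the left at 1 without interchanging a limit and an infinite
  sum.\<close>

lemma sum_coeff_squares_le:
  assumes "stable_system M"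
  shows "(\<Sum>k<K. (fps_nth M k)\<^sup>2) \<le> (hinf_norm M)\<^sup>2"
proof -
  have "((\<lambda>r. \<Sum>k<K. (fps_nth M k * r ^ k)\<^sup>2) \<longlongrightarrow> (\<Sum>k<K. (fps_nth M k * 1 ^ k)\<^sup>2)) (at_left 1)"
    by (intro tendsto_intros)
  moreover have "\<forall>\<^sub>F r in at_left (1::real). (\<Sum>k<K. (fps_nth M k * r ^ k)\<^sup>2) \<le> (hinf_norm M)\<^sup>2"
    using eventually_at_left_real[of 0 1]
    by (auto elim!: eventually_mono intro!: sum_scaled_coeff_squares_le assms)
  ultimately show ?thesis
    using tendsto_upperbound[of _ _ "at_left (1::real)"] by fastforce
qed

text \<open>The partial sums are bounded by the squared H-infinity norm. Without convergence the
  infinite sum inside \<open>h2_norm\<close> would carry no information.\<close>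

lemma summable_coeff_squares: "stable_system M \<Longrightarrow> summable (\<lambda>k. (fps_nth M k)\<^sup>2)"
  using sum_coeff_squares_le[of M] by (intro bounded_imp_summable[where B = "(hinf_norm M)\<^sup>2"])
    (auto simp del: lessThan_Suc sum.lessThan_Suc simp flip: lessThan_Suc_atMost)

lemma h2_norm_nonneg: "stable_system M \<Longrightarrow> 0 \<le> h2_norm M"
  unfolding h2_norm_def by (simp add: suminf_nonneg summable_coeff_squares)

lemma h2_norm_square: "stable_system M \<Longrightarrow> (h2_norm M)\<^sup>2 = (\<Sum>k. (fps_nth M k)\<^sup>2)"
  unfolding h2_norm_def by (simp add: suminf_nonneg summable_coeff_squares)

lemma h2_norm_0 [simp]: "h2_norm 0 = 0"
  by (simp add: h2_norm_def)

lemma h2_norm_le_hinf_norm: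
  assumes "stable_system M"
  shows "h2_norm M \<le> hinf_norm M"
proof (rule power2_le_imp_le)
  show "(h2_norm M)\<^sup>2 \<le> (hinf_norm M)\<^sup>2"
    unfolding h2_norm_square[OF assms]
    using sum_coeff_squares_le[OF assms] summable_coeff_squares[OF assms]
    by (intro suminf_le_const)
qed (rule hinf_norm_nonneg[OF assms])

lemma h2_norm_eq_0_iff:
  assumes "stable_system M"
  shows "h2_norm M = 0 \<longleftrightarrow> M = 0"
proof
  assume "h2_norm M = 0"
  then have "(\<Sum>k. (fps_nth M k)\<^sup>2) = 0"
    using h2_norm_square[OF assms] by simp
  then show "M = 0"
    by (subst (asm) suminf_eq_zero_iff[OF summable_coeff_squares[OF assms]])
      (auto simp: fps_eq_iff)
qed simp

section \<open>Pythagoras for the deviation from the mean\<close>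

text \<open>This is the variance identity. With \<open>S\<close> the total, the cross term
  contributes \<open>- 2 * S^2 / n\<close> and the constant term \<open>S^2 / n\<close>.\<close>

lemma sum_deviation_squares:
  fixes x :: "nat \<Rightarrow> real"
  assumes "1 \<le> n"
  shows "(\<Sum>i<n. (x i - (\<Sum>l<n. x l) / real n)\<^sup>2) + (\<Sum>l<n. x l)\<^sup>2 / real n = (\<Sum>i<n. (x i)\<^sup>2)"
proof -
  define S where "S = (\<Sum>l<n. x l)"
  have "(\<Sum>i<n. (x i - S / real n)\<^sup>2) = (\<Sum>i<n. (x i)\<^sup>2) - 2 * S / real n * S + real n * (S / real n)\<^sup>2"
  proof -
    have "(x i - S / real n)\<^sup>2 = (x i)\<^sup>2 - 2 * S / real n * x i + (S / real n)\<^sup>2" for i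
      by (simp add: power2_diff)
    then show ?thesis
      by (simp add: sum.distrib sum_subtractf S_def flip: sum_distrib_left sum_divide_distrib)
  qed
  then show ?thesis
    using assms unfolding S_def[symmetric] by (simp add: field_simps power2_eq_square)
qed

text \<open>The variance identity holds at each time \<open>k\<close> for the impulse responses;
  summing over \<open>k\<close> is legitimate because all systems involved are stable.\<close>

lemma h2_norm_deviation_squares:
  fixes f :: "nat \<Rightarrow> system"
  assumes n: "1 \<le> n" and stable: "\<And>i. i < n \<Longrightarrow> stable_system (f i)"
  shows "(\<Sum>i<n. (h2_norm (f i - fps_const (1 / real n) * (\<Sum>l<n. f l)))\<^sup>2)
      + (h2_norm (\<Sum>l<n. f l))\<^sup>2 / real n = (\<Sum>i<n. (h2_norm (f i))\<^sup>2)"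
proof -
  let ?s = "\<Sum>l<n. f l"
  let ?d = "\<lambda>i. f i - fps_const (1 / real n) * ?s"
  have s: "stable_system ?s"
    using stable by (intro stable_system_sum) auto
  have d: "stable_system (?d i)" if "i < n" for i
    using that by (intro stable_system_diff stable_system_mult stable_system_const s stable)
  have h2_sums: "(\<lambda>k. (fps_nth M k)\<^sup>2) sums (h2_norm M)\<^sup>2" if "stable_system M" for M
    using that by (simp add: h2_norm_square summable_coeff_squares summable_sums)
  have "(\<lambda>k. (\<Sum>i<n. (fps_nth (?d i) k)\<^sup>2) + (fps_nth ?s k)\<^sup>2 / real n)
      sums ((\<Sum>i<n. (h2_norm (?d i))\<^sup>2) + (h2_norm ?s)\<^sup>2 / real n)"
    using s d by (intro sums_add sums_sum sums_divide h2_sums) auto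
  moreover have "(\<Sum>i<n. (fps_nth (?d i) k)\<^sup>2) + (fps_nth ?s k)\<^sup>2 / real n
      = (\<Sum>i<n. (fps_nth (f i) k)\<^sup>2)" for k
    using sum_deviation_squares[OF n, of "\<lambda>i. fps_nth (f i) k"] by (simp add: fps_sum_nth)
  moreover have "(\<lambda>k. \<Sum>i<n. (fps_nth (f i) k)\<^sup>2) sums (\<Sum>i<n. (h2_norm (f i))\<^sup>2)"
    using stable by (intro sums_sum h2_sums) auto
  ultimately show ?thesis
    by (simp add: sums_iff)
qed

section \<open>The two cost functions\<close>

lemma h2_norm_mat_square:
  "(h2_norm_mat A)\<^sup>2 = (\<Sum>i<dim_row A. \<Sum>j<dim_col A. (h2_norm (A $$ (i, j)))\<^sup>2)"
  unfolding h2_norm_mat_def by (simp add: sum_nonneg)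

lemma h2_norm_mat_nonneg: "0 \<le> h2_norm_mat A"
  unfolding h2_norm_mat_def by (simp add: sum_nonneg)

lemma mu_cost_nonneg: "0 \<le> mu_cost H U V n Q"
  unfolding mu_cost_def by (simp add: h2_norm_mat_nonneg)

lemma psi_cost_nonneg: "0 \<le> psi_cost H U V n Q"
  unfolding psi_cost_def by (simp add: h2_norm_mat_nonneg)

section \<open>Entries of the closed loop and of its deviation from the mean\<close>

lemma closed_loop_carrier:
  assumes "Q \<in> carrier_mat n n"
  shows "closed_loop H U V n Q \<in> carrier_mat n n"
  using assms unfolding closed_loop_def by (auto simp: mat_diag_def)

lemma closed_loop_index:
  assumes "Q \<in> carrier_mat n n" "i < n" "j < n"
  shows "closed_loop H U V n Q $$ (i, j) = (if i = j then H i else 0) - U i * Q $$ (i, j) * V j"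
proof -
  have UQ: "mat_diag n U * Q = Matrix.mat n n (\<lambda>(i, j). U i * Q $$ (i, j))"
    using assms(1) by (rule mat_diag_mult_left)
  have "mat_diag n U * Q * mat_diag n V = Matrix.mat n n (\<lambda>(i, j). U i * Q $$ (i, j) * V j)"
    unfolding UQ by (subst mat_diag_mult_right) auto
  then show ?thesis
    using assms(2,3) by (simp add: closed_loop_def mat_diag_def)
qed

lemma deviation_mat_mult_index:
  assumes A: "A \<in> carrier_mat n n" and i: "i < n" "j < n"
  shows "(deviation_mat n * A) $$ (i, j)
    = A $$ (i, j) - fps_const (1 / real n) * (\<Sum>l<n. A $$ (l, j))"
proof -
  have "(deviation_mat n * A) $$ (i, j)
      = (\<Sum>l<n. ((if i = l then 1 else 0) - fps_const (1 / real n)) * A $$ (l, j))"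
    using assms by (auto simp: deviation_mat_def scalar_prod_def atLeast0LessThan intro!: sum.cong)
  also have "\<dots> = (\<Sum>l<n. if i = l then A $$ (l, j) else 0)
      - (\<Sum>l<n. fps_const (1 / real n) * A $$ (l, j))"
    unfolding sum_subtractf[symmetric] by (intro sum.cong) (auto simp: algebra_simps)
  finally show ?thesis
    using i by (simp add: sum_distrib_left)
qed

lemma deviation_mat_mult_carrier:
  "A \<in> carrier_mat n n \<Longrightarrow> deviation_mat n * A \<in> carrier_mat n n"
  by (auto simp: deviation_mat_def)

text \<open>Left multiplication by \<open>deviation_mat n\<close> subtracts from each entry the mean
  of its column. The two sums are swapped so that the vector identity applies to each
  column.\<close>

lemma h2_norm_mat_square_deviation:
  assumes A: "A \<in> carrier_mat n n" and n: "1 \<le> n"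
    and stable: "\<And>i j. i < n \<Longrightarrow> j < n \<Longrightarrow> stable_system (A $$ (i, j))"
  shows "(h2_norm_mat (deviation_mat n * A))\<^sup>2
      + (\<Sum>j<n. (h2_norm (\<Sum>i<n. A $$ (i, j)))\<^sup>2) / real n = (h2_norm_mat A)\<^sup>2"
proof -
  have dims: "dim_row (deviation_mat n * A) = n" "dim_col (deviation_mat n * A) = n"
    using deviation_mat_mult_carrier[OF A] by auto
  have "(h2_norm_mat (deviation_mat n * A))\<^sup>2
      = (\<Sum>j<n. \<Sum>i<n. (h2_norm (A $$ (i, j) - fps_const (1 / real n) * (\<Sum>l<n. A $$ (l, j))))\<^sup>2)"
    unfolding h2_norm_mat_square dims
    by (subst sum.swap) (simp add: deviation_mat_mult_index[OF A])
  then have "(h2_norm_mat (deviation_mat n * A))\<^sup>2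
      + (\<Sum>j<n. (h2_norm (\<Sum>i<n. A $$ (i, j)))\<^sup>2) / real n
      = (\<Sum>j<n. \<Sum>i<n. (h2_norm (A $$ (i, j)))\<^sup>2)"
    by (simp add: sum_divide_distrib h2_norm_deviation_squares[OF n stable] flip: sum.distrib)
  also have "\<dots> = (h2_norm_mat A)\<^sup>2"
    unfolding h2_norm_mat_square using A by (subst sum.swap) auto
  finally show ?thesis .
qed

section \<open>The feasible set\<close>

lemma feasible_carrier: "Q \<in> feasible \<alpha> \<gamma> n \<Longrightarrow> Q \<in> carrier_mat n n"
  by (simp add: feasible_def)

lemma feasible_stable:
  "Q \<in> feasible \<alpha> \<gamma> n \<Longrightarrow> i < n \<Longrightarrow> j < n \<Longrightarrow> stable_system (Q $$ (i, j))"
  by (simp add: feasible_def)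

text \<open>Dominance charges all off-diagonal entries of a column to its diagonal entry, so the
  bound grows with \<open>n\<close> only through \<open>\<alpha> n\<close>, not through the number
  of summands.\<close>

lemma feasible_column_sum_le:
  assumes Q: "Q \<in> feasible \<alpha> \<gamma> n" and a: "0 \<le> \<alpha> n" and j: "j < n"
  shows "(\<Sum>i<n. hinf_norm (Q $$ (i, j))) \<le> (1 + \<alpha> n) * \<gamma> j"
proof -
  have "(\<Sum>i<n. hinf_norm (Q $$ (i, j)))
      = hinf_norm (Q $$ (j, j)) + (\<Sum>i\<in>{..<n} - {j}. hinf_norm (Q $$ (i, j)))"
    using j by (intro sum.remove) auto
  also have "(\<Sum>i\<in>{..<n} - {j}. hinf_norm (Q $$ (i, j))) \<le> \<alpha> n * hinf_norm (Q $$ (j, j))"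
    using Q j by (simp add: feasible_def col_diag_dominant_def)
  also have "hinf_norm (Q $$ (j, j)) + \<alpha> n * hinf_norm (Q $$ (j, j))
      = (1 + \<alpha> n) * hinf_norm (Q $$ (j, j))"
    by (simp add: algebra_simps)
  also have "\<dots> \<le> (1 + \<alpha> n) * \<gamma> j"
    using Q j a by (intro mult_left_mono) (auto simp: feasible_def)
  finally show ?thesis
    by simp
qed

text \<open>The off-diagonal sums become 0, and \<open>0 \<le> \<alpha> n\<close> keeps the other
  side of the dominance condition nonnegative.\<close>

lemma mat_diag_feasible:
  assumes Q: "Q \<in> feasible \<alpha> \<gamma> n" and a: "0 \<le> \<alpha> n"
  shows "mat_diag n (\<lambda>i. Q $$ (i, i)) \<in> feasible \<alpha> \<gamma> n"
  using assms feasible_stable[OF Q]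
  by (auto simp: feasible_def mat_diag_def col_diag_dominant_def stable_system_0
      intro!: sum_nonneg mult_nonneg_nonneg hinf_norm_nonneg)

text \<open>This makes the feasible set nonempty, so that the infima of the costs are
  meaningful.\<close>

lemma zero_mat_feasible:
  assumes "\<And>i. 0 < \<gamma> i"
  shows "0\<^sub>m n n \<in> feasible \<alpha> \<gamma> n"
  using assms by (auto simp: feasible_def col_diag_dominant_def stable_system_0 less_imp_le)

section \<open>Infima and near minimizers of uniformly close functions\<close>

lemma abs_minimal_value_diff_le:
  assumes ne: "S \<noteq> {}" and bdd: "\<And>x. x \<in> S \<Longrightarrow> 0 \<le> f x" "\<And>x. x \<in> S \<Longrightarrow> 0 \<le> g x"
    and close: "\<And>x. x \<in> S \<Longrightarrow> \<bar>f x - g x\<bar> \<le> e"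
  shows "\<bar>minimal_value f S - minimal_value g S\<bar> \<le> e"
proof -
  have bdd_below: "bdd_below (f ` S)" "bdd_below (g ` S)"
    using bdd by (auto intro!: bdd_belowI[of _ 0])
  have "minimal_value f S - e \<le> minimal_value g S"
    unfolding minimal_value_def
  proof (rule cINF_greatest[OF ne])
    fix x assume x: "x \<in> S"
    show "(INF x\<in>S. f x) - e \<le> g x"
      using cINF_lower[OF bdd_below(1) x] close[OF x] by linarith
  qed
  moreover have "minimal_value g S - e \<le> minimal_value f S"
    unfolding minimal_value_def
  proof (rule cINF_greatest[OF ne])
    fix x assume x: "x \<in> S"
    show "(INF x\<in>S. g x) - e \<le> f x"
      using cINF_lower[OF bdd_below(2) x] close[OF x] by linarith
  qed
  ultimately show ?thesis
    by linarith
qed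

text \<open>The error \<open>e\<close> is paid twice: once for the value at \<open>x\<close> and
  once for the infimum.\<close>

lemma near_minimizer_transfer:
  assumes ne: "S \<noteq> {}" and bdd: "\<And>x. x \<in> S \<Longrightarrow> 0 \<le> f x" "\<And>x. x \<in> S \<Longrightarrow> 0 \<le> g x"
    and close: "\<And>x. x \<in> S \<Longrightarrow> \<bar>f x - g x\<bar> \<le> e"
    and x: "near_minimizer g S \<delta> x"
  shows "near_minimizer f S (\<delta> + 2 * e) x"
proof -
  have "\<bar>minimal_value f S - minimal_value g S\<bar> \<le> e"
    using ne bdd close by (rule abs_minimal_value_diff_le)
  moreover have "\<bar>f x - g x\<bar> \<le> e"
    using x by (intro close) (simp add: near_minimizer_def)
  ultimately show ?thesis
    using x unfolding near_minimizer_def by linarith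
qed

section \<open>Uniform closeness of the two costs\<close>

locale agents =
  fixes H U V :: "nat \<Rightarrow> system"
    and \<gamma>\<^sub>h \<gamma>\<^sub>u \<gamma>\<^sub>v :: real
  assumes stable_H: "\<And>i. stable_system (H i)" and H_le: "\<And>i. hinf_norm (H i) \<le> \<gamma>\<^sub>h"
    and stable_U: "\<And>i. stable_system (U i)" and U_le: "\<And>i. hinf_norm (U i) \<le> \<gamma>\<^sub>u"
    and stable_V: "\<And>i. stable_system (V i)" and V_le: "\<And>i. hinf_norm (V i) \<le> \<gamma>\<^sub>v"
begin

lemma bounds_nonneg: "0 \<le> \<gamma>\<^sub>h" "0 \<le> \<gamma>\<^sub>u" "0 \<le> \<gamma>\<^sub>v"
  using order_trans[OF hinf_norm_nonneg[OF stable_H] H_le]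
    order_trans[OF hinf_norm_nonneg[OF stable_U] U_le]
    order_trans[OF hinf_norm_nonneg[OF stable_V] V_le] by auto

lemma stable_closed_loop:
  assumes "Q \<in> feasible \<alpha> \<gamma> n" "i < n" "j < n"
  shows "stable_system (closed_loop H U V n Q $$ (i, j))"
  unfolding closed_loop_index[OF feasible_carrier[OF assms(1)] assms(2,3)]
  using stable_H
  by (intro stable_system_diff stable_system_mult stable_U stable_V feasible_stable[OF assms])
    (simp add: stable_system_0)

lemma hinf_norm_closed_loop_le:
  assumes "Q \<in> feasible \<alpha> \<gamma> n" "i < n" "j < n"
  shows "hinf_norm (closed_loop H U V n Q $$ (i, j))
    \<le> (if i = j then \<gamma>\<^sub>h else 0) + \<gamma>\<^sub>u * \<gamma>\<^sub>v * hinf_norm (Q $$ (i, j))"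
proof -
  let ?q = "Q $$ (i, j)"
  have q: "stable_system ?q"
    using assms by (rule feasible_stable)
  have Uq: "stable_system (U i * ?q)"
    by (intro stable_system_mult stable_U q)
  have "hinf_norm (U i * ?q * V j) \<le> hinf_norm (U i * ?q) * hinf_norm (V j)"
    by (intro hinf_norm_mult_le Uq stable_V)
  also have "\<dots> \<le> (hinf_norm (U i) * hinf_norm ?q) * hinf_norm (V j)"
    by (intro mult_right_mono hinf_norm_mult_le hinf_norm_nonneg stable_U stable_V q)
  also have "\<dots> \<le> (\<gamma>\<^sub>u * hinf_norm ?q) * \<gamma>\<^sub>v"
    using bounds_nonneg
    by (intro mult_mono mult_nonneg_nonneg hinf_norm_nonneg stable_U stable_V q U_le V_le order_refl)
  finally have "hinf_norm (U i * ?q * V j) \<le> \<gamma>\<^sub>u * \<gamma>\<^sub>v * hinf_norm ?q"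
    by (simp add: mult_ac)
  moreover have "hinf_norm (if i = j then H i else 0) \<le> (if i = j then \<gamma>\<^sub>h else 0)"
    using H_le by simp
  moreover have "hinf_norm ((if i = j then H i else 0) - U i * ?q * V j)
      \<le> hinf_norm (if i = j then H i else 0) + hinf_norm (U i * ?q * V j)"
    using stable_H
    by (intro hinf_norm_diff_le stable_system_mult[OF Uq stable_V]) (simp add: stable_system_0)
  ultimately show ?thesis
    unfolding closed_loop_index[OF feasible_carrier[OF assms(1)] assms(2,3)] by linarith
qed

text \<open>The estimate passes to the H-infinity norm at once, because that norm is
  submultiplicative and is the one in which dominance is stated.\<close>

lemma h2_norm_column_sum_le:
  assumes Q: "Q \<in> feasible \<alpha> \<gamma> n" and a: "0 \<le> \<alpha> n" and G: "\<And>i. \<gamma> i \<le> G" and j: "j < n"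
  shows "h2_norm (\<Sum>i<n. closed_loop H U V n Q $$ (i, j)) \<le> \<gamma>\<^sub>h + \<gamma>\<^sub>u * \<gamma>\<^sub>v * ((1 + \<alpha> n) * G)"
proof -
  let ?\<Phi> = "closed_loop H U V n Q"
  have \<Phi>: "stable_system (?\<Phi> $$ (i, j))" if "i < n" for i
    using Q that j by (rule stable_closed_loop)
  have "h2_norm (\<Sum>i<n. ?\<Phi> $$ (i, j)) \<le> hinf_norm (\<Sum>i<n. ?\<Phi> $$ (i, j))"
    using \<Phi> by (intro h2_norm_le_hinf_norm stable_system_sum) auto
  also have "\<dots> \<le> (\<Sum>i<n. hinf_norm (?\<Phi> $$ (i, j)))"
    using \<Phi> by (intro hinf_norm_sum_le) auto
  also have "\<dots> \<le> (\<Sum>i<n. (if i = j then \<gamma>\<^sub>h else 0) + \<gamma>\<^sub>u * \<gamma>\<^sub>v * hinf_norm (Q $$ (i, j)))"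
    using j by (intro sum_mono hinf_norm_closed_loop_le[OF Q]) auto
  also have "\<dots> = \<gamma>\<^sub>h + \<gamma>\<^sub>u * \<gamma>\<^sub>v * (\<Sum>i<n. hinf_norm (Q $$ (i, j)))"
    using j by (simp add: sum.distrib sum_distrib_left)
  also have "(\<Sum>i<n. hinf_norm (Q $$ (i, j))) \<le> (1 + \<alpha> n) * \<gamma> j"
    using Q a j by (rule feasible_column_sum_le)
  also have "\<dots> \<le> (1 + \<alpha> n) * G"
    using a G by (intro mult_left_mono) auto
  finally show ?thesis
    using bounds_nonneg by (simp add: mult_left_mono)
qed

text \<open>With \<open>B\<close> the bound on column sums, Pythagoras gives
  \<open>psi^2 \<le> mu^2 \<le> psi^2 + B^2 / n\<close>. Taking square roots yields the
  claim.\<close>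

lemma abs_psi_cost_diff_mu_cost_le:
  assumes Q: "Q \<in> feasible \<alpha> \<gamma> n" and a: "0 \<le> \<alpha> n" and G: "\<And>i. \<gamma> i \<le> G" "0 \<le> G" and n: "1 \<le> n"
  shows "\<bar>psi_cost H U V n Q - mu_cost H U V n Q\<bar>
    \<le> (\<gamma>\<^sub>h + \<gamma>\<^sub>u * \<gamma>\<^sub>v * ((1 + \<alpha> n) * G)) / sqrt (real n)"
proof -
  define B where "B = \<gamma>\<^sub>h + \<gamma>\<^sub>u * \<gamma>\<^sub>v * ((1 + \<alpha> n) * G)"
  have B: "0 \<le> B"
    unfolding B_def using bounds_nonneg a G by simp
  let ?\<Phi> = "closed_loop H U V n Q"
  let ?p = "psi_cost H U V n Q" and ?m = "mu_cost H U V n Q"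
  define s where "s = (\<Sum>j<n. (h2_norm (\<Sum>i<n. ?\<Phi> $$ (i, j)))\<^sup>2)"
  have s_nonneg: "0 \<le> s"
    unfolding s_def by (simp add: sum_nonneg)
  have "s \<le> (\<Sum>j<n. B\<^sup>2)"
    unfolding s_def B_def
    by (intro sum_mono power_mono h2_norm_column_sum_le[OF Q a G(1)] h2_norm_nonneg
        stable_system_sum stable_closed_loop[OF Q]) auto
  then have s_le: "s \<le> real n * B\<^sup>2"
    by simp
  have "(h2_norm_mat (deviation_mat n * ?\<Phi>))\<^sup>2 + s / real n = (h2_norm_mat ?\<Phi>)\<^sup>2"
    unfolding s_def using n Q
    by (intro h2_norm_mat_square_deviation closed_loop_carrier feasible_carrier stable_closed_loop)
  then have "((h2_norm_mat (deviation_mat n * ?\<Phi>))\<^sup>2 + s / real n) / real n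
      = (h2_norm_mat ?\<Phi>)\<^sup>2 / real n"
    by simp
  \<comment> \<open>One factor \<open>1 / real n\<close> comes from the mean, the other from the
    normalization of the costs.\<close>
  then have eq: "?p\<^sup>2 + s / (real n)\<^sup>2 = ?m\<^sup>2"
    unfolding psi_cost_def mu_cost_def
    by (simp add: power_mult_distrib power_divide add_divide_distrib power2_eq_square[of "real n"])
  have "s / (real n)\<^sup>2 \<le> (real n * B\<^sup>2) / (real n)\<^sup>2"
    using s_le by (rule divide_right_mono) simp
  also have "\<dots> = (B / sqrt (real n))\<^sup>2"
    using n by (simp add: power_divide power2_eq_square[of "real n"])
  finally have "?m\<^sup>2 \<le> ?p\<^sup>2 + (B / sqrt (real n))\<^sup>2"
    using eq by linarith
  \<comment> \<open>The cross term of the square is nonnegative and is simply added.\<close>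
  also have "\<dots> \<le> (?p + B / sqrt (real n))\<^sup>2"
    using B psi_cost_nonneg[of H U V n Q] by (simp add: power2_sum)
  finally have "?m \<le> ?p + B / sqrt (real n)"
    by (rule power2_le_imp_le) (use B psi_cost_nonneg in simp)
  moreover have "?p\<^sup>2 \<le> ?m\<^sup>2"
    using eq s_nonneg by (simp flip: eq)
  then have "?p \<le> ?m"
    by (rule power2_le_imp_le) (rule mu_cost_nonneg)
  ultimately show ?thesis
    unfolding B_def[symmetric] by linarith
qed

section \<open>Discarding the off-diagonal entries\<close>

text \<open>Diagonal entries of the closed loop see only the diagonal of \<open>Q\<close>, while
  off-diagonal ones contain no \<open>H\<close>. The squared norm is a sum over entries, so the two
  contributions separate.\<close>

lemma mu_cost_square_diag:
  assumes Q: "Q \<in> feasible \<alpha> \<gamma> n"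
  shows "(mu_cost H U V n Q)\<^sup>2 = (mu_cost H U V n (mat_diag n (\<lambda>i. Q $$ (i, i))))\<^sup>2
    + (\<Sum>i<n. \<Sum>j<n. if i = j then 0 else (h2_norm (- (U i * Q $$ (i, j) * V j)))\<^sup>2) / real n"
proof -
  let ?D = "mat_diag n (\<lambda>i. Q $$ (i, i))"
  have D: "?D \<in> carrier_mat n n"
    by (simp add: mat_diag_def)
  have entry: "?D $$ (i, j) = (if i = j then Q $$ (j, j) else 0)" if "i < n" "j < n" for i j
    using that by (simp add: mat_diag_def)
  have sq: "(mu_cost H U V n R)\<^sup>2
      = (\<Sum>i<n. \<Sum>j<n. (h2_norm (closed_loop H U V n R $$ (i, j)))\<^sup>2) / real n"
    if "R \<in> carrier_mat n n" for R
    using closed_loop_carrier[OF that, of H U V]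
    by (simp add: mu_cost_def power_mult_distrib power_divide h2_norm_mat_square)
  show ?thesis
    unfolding sq[OF D] sq[OF feasible_carrier[OF Q]] add_divide_distrib[symmetric]
      sum.distrib[symmetric]
    by (intro arg_cong2[of _ _ _ _ "(/)"] sum.cong refl)
      (auto simp: closed_loop_index[OF D] closed_loop_index[OF feasible_carrier[OF Q]] entry)
qed

lemma mu_cost_diag_le:
  assumes Q: "Q \<in> feasible \<alpha> \<gamma> n"
  shows "mu_cost H U V n (mat_diag n (\<lambda>i. Q $$ (i, i))) \<le> mu_cost H U V n Q"
proof (rule power2_le_imp_le)
  show "(mu_cost H U V n (mat_diag n (\<lambda>i. Q $$ (i, i))))\<^sup>2 \<le> (mu_cost H U V n Q)\<^sup>2"
    unfolding mu_cost_square_diag[OF Q] by (auto intro!: divide_nonneg_nonneg sum_nonneg)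
qed (rule mu_cost_nonneg)

lemma near_minimizer_mu_cost_diag:
  assumes "near_minimizer (mu_cost H U V n) (feasible \<alpha> \<gamma> n) \<delta> Q" and "0 \<le> \<alpha> n"
  shows "near_minimizer (mu_cost H U V n) (feasible \<alpha> \<gamma> n) \<delta> (mat_diag n (\<lambda>i. Q $$ (i, i)))"
  using assms mu_cost_diag_le[of Q \<alpha> \<gamma> n] mat_diag_feasible[of Q \<alpha> \<gamma> n]
  unfolding near_minimizer_def by auto

text \<open>Comparison with the diagonal part forces every discarded term to vanish. A stable system
  of zero H2 norm is 0, and real power series have no zero divisors, so the nonzero factors
  \<open>U i\<close> and \<open>V j\<close> cancel.\<close>

lemma minimizer_mu_cost_offdiagonal:
  assumes Q: "is_arg_min (mu_cost H U V n) (\<lambda>Q. Q \<in> feasible \<alpha> \<gamma> n) Q" and a: "0 \<le> \<alpha> n"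
    and ij: "i < n" "j < n" "i \<noteq> j" and UV: "U i \<noteq> 0" "V j \<noteq> 0"
  shows "Q $$ (i, j) = 0"
proof -
  define t where
    "t = (\<lambda>i j. if i = j then 0 else (h2_norm (- (U i * Q $$ (i, j) * V j)))\<^sup>2)"
  have t: "0 \<le> t i j" for i j
    by (simp add: t_def)
  have feas: "Q \<in> feasible \<alpha> \<gamma> n"
    using Q by (simp add: is_arg_min_def)
  have "mu_cost H U V n Q \<le> mu_cost H U V n (mat_diag n (\<lambda>i. Q $$ (i, i)))"
    using Q mat_diag_feasible[OF feas a] by (simp add: is_arg_min_linorder)
  then have "(mu_cost H U V n Q)\<^sup>2 \<le> (mu_cost H U V n (mat_diag n (\<lambda>i. Q $$ (i, i))))\<^sup>2"
    by (intro power_mono mu_cost_nonneg)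
  then have "(\<Sum>i<n. \<Sum>j<n. t i j) / real n \<le> 0"
    unfolding mu_cost_square_diag[OF feas] t_def by linarith
  then have "(\<Sum>i<n. \<Sum>j<n. t i j) \<le> 0"
    using ij(1) by (simp add: divide_le_0_iff)
  then have "(\<Sum>i<n. \<Sum>j<n. t i j) = 0"
    using t by (intro antisym sum_nonneg) auto
  then have "t i j = 0"
    using t ij by (simp add: sum_nonneg_eq_0_iff sum_nonneg)
  \<comment> \<open>Writing the negation as a difference from 0 lets closure under differences
    apply.\<close>
  moreover have "stable_system (0 - U i * Q $$ (i, j) * V j)"
    by (intro stable_system_diff stable_system_mult stable_system_0 stable_U stable_V
        feasible_stable[OF feas] ij)
  ultimately have "U i * Q $$ (i, j) * V j = 0"
    using ij by (simp add: t_def h2_norm_eq_0_iff)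
  then show ?thesis
    using UV by simp
qed

end

section \<open>The limit and the asymptotic optimality\<close>

lemma error_bound_tendsto_0:
  fixes \<alpha> :: "nat \<Rightarrow> real"
  assumes "\<alpha> \<in> o(\<lambda>n. sqrt (real n))"
  shows "(\<lambda>n. (a + b * ((1 + \<alpha> n) * c)) / sqrt (real n)) \<longlonglongrightarrow> 0"
proof -
  have "(\<lambda>n. \<alpha> n / sqrt (real n)) \<longlonglongrightarrow> 0"
    using assms by (rule smalloD_tendsto)
  moreover have "(\<lambda>n. 1 / sqrt (real n)) \<longlonglongrightarrow> 0"
    by real_asymp
  ultimately have "(\<lambda>n. (a + b * c) * (1 / sqrt (real n)) + b * c * (\<alpha> n / sqrt (real n)))
      \<longlonglongrightarrow> (a + b * c) * 0 + b * c * 0"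
    by (intro tendsto_intros)
  then show ?thesis
    by (simp add: algebra_simps add_divide_distrib)
qed

text \<open>An off-diagonal entry \<open>Q $$ (i, j)\<close> with \<open>U i = 0\<close> or
  \<open>V j = 0\<close> does not influence the cost \<open>mu_cost\<close>, so a minimizer need not
  vanish there; its diagonal part is again a minimizer. Optimality for \<open>psi_cost\<close> is
  asymptotic: for each \<epsilon> one threshold on \<open>n\<close> serves all tolerances \<delta>
  and all \<open>Q\<close>, with \<delta> = 0 for exact minimizers.\<close>

theorem theorem2:
  fixes H U V :: "nat \<Rightarrow> system"
    and \<gamma>\<^sub>h \<gamma>\<^sub>u \<gamma>\<^sub>v :: real
    and \<gamma> \<alpha> :: "nat \<Rightarrow> real"
  assumes "\<And>i. stable_system (H i)" and "\<And>i. hinf_norm (H i) \<le> \<gamma>\<^sub>h"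
    and "\<And>i. stable_system (U i)" and "\<And>i. hinf_norm (U i) \<le> \<gamma>\<^sub>u"
    and "\<And>i. stable_system (V i)" and "\<And>i. hinf_norm (V i) \<le> \<gamma>\<^sub>v"
    and "\<And>i. 0 < \<gamma> i" and "bdd_above (range \<gamma>)"
    and "\<And>n. 1 \<le> n \<Longrightarrow> 0 < \<alpha> n" and "\<alpha> \<in> o(\<lambda>n. sqrt (real n))"
  shows
    "((\<lambda>n. minimal_value (psi_cost H U V n) (feasible \<alpha> \<gamma> n)
          - minimal_value (mu_cost H U V n) (feasible \<alpha> \<gamma> n)) \<longlonglongrightarrow> 0)
     \<and> (\<forall>n\<ge>1. \<forall>Q. is_arg_min (mu_cost H U V n) (\<lambda>Q. Q \<in> feasible \<alpha> \<gamma> n) Q \<longrightarrow>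
          (\<forall>i<n. \<forall>j<n. i \<noteq> j \<and> U i \<noteq> 0 \<and> V j \<noteq> 0 \<longrightarrow> Q $$ (i, j) = 0)
          \<and> is_arg_min (mu_cost H U V n) (\<lambda>Q. Q \<in> feasible \<alpha> \<gamma> n)
               (mat_diag n (\<lambda>i. Q $$ (i, i))))
     \<and> (\<forall>n\<ge>1. \<forall>\<delta>\<ge>0. \<forall>Q. near_minimizer (mu_cost H U V n) (feasible \<alpha> \<gamma> n) \<delta> Q \<longrightarrow>
          near_minimizer (mu_cost H U V n) (feasible \<alpha> \<gamma> n) \<delta> (mat_diag n (\<lambda>i. Q $$ (i, i))))
     \<and> (\<forall>\<epsilon>>0. \<forall>\<^sub>F n in sequentially. \<forall>\<delta>\<ge>0. \<forall>Q.
          near_minimizer (mu_cost H U V n) (feasible \<alpha> \<gamma> n) \<delta> Q \<longrightarrow>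
          near_minimizer (psi_cost H U V n) (feasible \<alpha> \<gamma> n) (\<delta> + \<epsilon>) Q)"
proof -
  interpret agents H U V \<gamma>\<^sub>h \<gamma>\<^sub>u \<gamma>\<^sub>v
    using assms(1-6) by unfold_locales
  obtain G where G: "\<And>i. \<gamma> i \<le> G"
    using assms(8) unfolding bdd_above_def by auto
  have G_nonneg: "0 \<le> G"
    using less_le_trans[OF assms(7) G] by (rule less_imp_le)
  have \<alpha>_nonneg: "0 \<le> \<alpha> n" if "1 \<le> n" for n
    using assms(9)[OF that] by simp
  let ?S = "feasible \<alpha> \<gamma>" and ?mu = "mu_cost H U V" and ?psi = "psi_cost H U V"
  \<comment> \<open>This bound does not depend on \<open>Q\<close>, so it controls the infima as
    well as the individual costs.\<close>
  define e where "e = (\<lambda>n. (\<gamma>\<^sub>h + \<gamma>\<^sub>u * \<gamma>\<^sub>v * ((1 + \<alpha> n) * G)) / sqrt (real n))"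
  have e_lim: "e \<longlonglongrightarrow> 0"
    unfolding e_def using assms(10) by (rule error_bound_tendsto_0)
  have ne: "?S n \<noteq> {}" for n
    using zero_mat_feasible[of \<gamma> n \<alpha>] assms(7) by auto
  have close: "\<bar>?psi n Q - ?mu n Q\<bar> \<le> e n" if "1 \<le> n" "Q \<in> ?S n" for n Q
    unfolding e_def using that \<alpha>_nonneg G G_nonneg by (intro abs_psi_cost_diff_mu_cost_le)
  have "(\<lambda>n. minimal_value (?psi n) (?S n) - minimal_value (?mu n) (?S n)) \<longlonglongrightarrow> 0"
  proof (rule tendsto_rabs_zero_cancel, rule tendsto_sandwich[OF _ _ tendsto_const e_lim])
    show "\<forall>\<^sub>F n in sequentially.
        \<bar>minimal_value (?psi n) (?S n) - minimal_value (?mu n) (?S n)\<bar> \<le> e n"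
      using eventually_ge_at_top[of 1]
      by eventually_elim (intro abs_minimal_value_diff_le ne psi_cost_nonneg mu_cost_nonneg close)
  qed simp
  moreover have "(\<forall>i<n. \<forall>j<n. i \<noteq> j \<and> U i \<noteq> 0 \<and> V j \<noteq> 0 \<longrightarrow> Q $$ (i, j) = 0)
      \<and> is_arg_min (?mu n) (\<lambda>Q. Q \<in> ?S n) (mat_diag n (\<lambda>i. Q $$ (i, i)))"
    if "1 \<le> n" "is_arg_min (?mu n) (\<lambda>Q. Q \<in> ?S n) Q" for n Q
    \<comment> \<open>Exact minimizers are near minimizers of tolerance 0, which covers the claim on
      the diagonal part.\<close>
    using that(2) minimizer_mu_cost_offdiagonal[OF that(2) \<alpha>_nonneg[OF that(1)]]
      near_minimizer_mu_cost_diag[where Q = Q and \<delta> = 0 and \<alpha> = \<alpha> and n = n and \<gamma> = \<gamma>]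
      \<alpha>_nonneg[OF that(1)]
    by (auto simp: is_arg_min_iff_near_minimizer mu_cost_nonneg)
  moreover have "near_minimizer (?mu n) (?S n) \<delta> (mat_diag n (\<lambda>i. Q $$ (i, i)))"
    if "1 \<le> n" "near_minimizer (?mu n) (?S n) \<delta> Q" for n \<delta> Q
    using that(2) \<alpha>_nonneg[OF that(1)] by (rule near_minimizer_mu_cost_diag)
  moreover have "\<forall>\<^sub>F n in sequentially. \<forall>\<delta>\<ge>0. \<forall>Q.
      near_minimizer (?mu n) (?S n) \<delta> Q \<longrightarrow> near_minimizer (?psi n) (?S n) (\<delta> + \<epsilon>) Q"
    if "\<epsilon> > 0" for \<epsilon>
  proof -
    \<comment> \<open>Half of \<epsilon>, because the transfer between the costs loses
      \<open>2 * e n\<close>.\<close>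
    have "\<forall>\<^sub>F n in sequentially. e n < \<epsilon> / 2"
      using that by (intro order_tendstoD(2)[OF e_lim]) simp
    then show ?thesis
      using eventually_ge_at_top[of 1]
    proof eventually_elim
      case (elim n)
      have "near_minimizer (?psi n) (?S n) (\<delta> + \<epsilon>) Q"
        if "near_minimizer (?mu n) (?S n) \<delta> Q" for \<delta> Q
      proof -
        have "near_minimizer (?psi n) (?S n) (\<delta> + 2 * e n) Q"
          using ne psi_cost_nonneg mu_cost_nonneg close[OF elim(2)] that
          by (rule near_minimizer_transfer)
        then show ?thesis
          using elim(1) unfolding near_minimizer_def by linarith
      qed
      then show ?case
        by blast
    qed
  qed
  ultimately show ?thesis
    by blast
qed

end
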